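(* Let $p,q$ be distinct primes and let $G$ be a group of order $p^3q$. Then the difference graph $D(G)$ is perfect.
   Context: For a group $G$, the power graph $\mathsf{Pow}(G)$ has vertex set $G$, with distinct $a,b$ adjacent iff $a\in\langle b\rangle$ or $b\in\langle a\rangle$. The enhanced power graph $\mathsf{EPow}(G)$ has vertex set $G$, with distinct $a,b$ adjacent iff $\langle a,b\rangle$ is cyclic. The difference graph $D(G)$ is the graph $\mathsf{EPow}(G)-\mathsf{Pow}(G)$ with all isolated vertices removed; thus $x\sim y$ in $D(G)$ iff $\langle x,y\rangle$ is cyclic, $x\notin\langle y\rangle$ and $y\notin\langle x\rangle$. *)

theory Defs
  imports
    "HOL-Computational_Algebra.Primes"
    "HOL-Algebra.Elementary_Groups"
    "Graph_Theory.Digraph_Component"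
begin

section \<open>Perfect graphs\<close>

text \<open>
  A finite simple graph is a symmetric loop-free digraph (locale \<^locale>\<open>graph\<close>, or
  \<^locale>\<open>pair_graph\<close> when arcs are pairs of vertices); the vertices \<open>x\<close>, \<open>y\<close> are
  adjacent in \<open>H\<close> iff \<open>(x, y) \<in> arcs_ends H\<close>. The numbers below have their intended
  meaning for such graphs; both are \<open>0\<close> for the graph without vertices.
\<close>

definition clique :: "('v, 'e) pre_digraph \<Rightarrow> 'v set \<Rightarrow> bool" where
  "clique H K \<longleftrightarrow>
     K \<subseteq> verts H \<and> (\<forall>x\<in>K. \<forall>y\<in>K. x \<noteq> y \<longrightarrow> (x, y) \<in> arcs_ends H)"

definition clique_number :: "('v, 'e) pre_digraph \<Rightarrow> nat" where
  "clique_number H = Max (card ` {K. clique H K})"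

definition proper_colouring :: "('v, 'e) pre_digraph \<Rightarrow> nat \<Rightarrow> ('v \<Rightarrow> nat) \<Rightarrow> bool" where
  "proper_colouring H k c \<longleftrightarrow>
     c ` verts H \<subseteq> {..<k} \<and> (\<forall>(x, y)\<in>arcs_ends H. c x \<noteq> c y)"

definition chromatic_number :: "('v, 'e) pre_digraph \<Rightarrow> nat" where
  "chromatic_number H = (LEAST k. \<exists>c. proper_colouring H k c)"

definition perfect_graph :: "('v, 'e) pre_digraph \<Rightarrow> bool" where
  "perfect_graph H \<longleftrightarrow>
     (\<forall>W\<subseteq>verts H.
        chromatic_number (induce_subgraph H W) = clique_number (induce_subgraph H W))"

section \<open>Graphs of a group\<close>

definition power_graph :: "('a, 'b) monoid_scheme \<Rightarrow> 'a pair_pre_digraph" where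
  "power_graph G =
     \<lparr>pverts = carrier G,
      parcs = {(a, b). a \<in> carrier G \<and> b \<in> carrier G \<and> a \<noteq> b \<and>
                       (a \<in> generate G {b} \<or> b \<in> generate G {a})}\<rparr>"

definition enhanced_power_graph :: "('a, 'b) monoid_scheme \<Rightarrow> 'a pair_pre_digraph" where
  "enhanced_power_graph G =
     \<lparr>pverts = carrier G,
      parcs = {(a, b). a \<in> carrier G \<and> b \<in> carrier G \<and> a \<noteq> b \<and>
                       cyclic_group (subgroup_generated G {a, b})}\<rparr>"

definition graph_difference ::
    "'v pair_pre_digraph \<Rightarrow> 'v pair_pre_digraph \<Rightarrow> 'v pair_pre_digraph" where
  "graph_difference H K = \<lparr>pverts = pverts H, parcs = parcs H - parcs K\<rparr>"

text \<open>For symmetric \<open>H\<close>, a vertex is isolated iff no arc starts at it.\<close>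

definition remove_isolated :: "'v pair_pre_digraph \<Rightarrow> 'v pair_pre_digraph" where
  "remove_isolated H =
     \<lparr>pverts = {x \<in> pverts H. \<exists>y. (x, y) \<in> parcs H}, parcs = parcs H\<rparr>"

definition difference_graph :: "('a, 'b) monoid_scheme \<Rightarrow> 'a pair_pre_digraph" where
  "difference_graph G =
     remove_isolated (graph_difference (enhanced_power_graph G) (power_graph G))"

lemma difference_graph_adjacent_iff:
  assumes "x \<in> carrier G" "y \<in> carrier G"
  shows "(x, y) \<in> parcs (difference_graph G) \<longleftrightarrow>
    cyclic_group (subgroup_generated G {x, y}) \<and> x \<notin> generate G {y} \<and> y \<notin> generate G {x}"
  using assms
  by (auto simp: difference_graph_def remove_isolated_def graph_difference_def
      enhanced_power_graph_def power_graph_def intro: generate.incl)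

lemma pair_graph_difference_graph:
  assumes "finite (carrier G)"
  shows "pair_graph (difference_graph G)"
proof -
  have "parcs (difference_graph G) \<subseteq> carrier G \<times> carrier G"
    by (auto simp: difference_graph_def remove_isolated_def graph_difference_def
        enhanced_power_graph_def)
  with assms have "finite (parcs (difference_graph G))"
    by (meson finite_SigmaI finite_subset)
  with assms show ?thesis
    by unfold_locales
      (auto simp: difference_graph_def remove_isolated_def graph_difference_def
        enhanced_power_graph_def power_graph_def symmetric_def insert_commute intro!: symI)
qed

end

theory Submission
  imports Defs "HOL-Algebra.Multiplicative_Group"
begin

text \<open>
  In a finite cyclic group, \<open>x\<close> lies in the subgroup generated by \<open>y\<close> as soon as the order of
  \<open>x\<close> divides that of \<open>y\<close>, so adjacent vertices of the difference graph have orders that are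
  incomparable for divisibility. Among the divisors of \<open>p\<^sup>n q\<close>, those not divisible by \<open>q\<close>
  form a chain, and so do those divisible by \<open>q\<close>. Hence the difference graph is bipartite,
  and bipartite graphs are perfect.
\<close>

lemma clique_card_le:
  assumes "clique H K" and "proper_colouring H k c"
  shows "card K \<le> k"
proof -
  have "inj_on c K"
    using assms unfolding clique_def proper_colouring_def inj_on_def by blast
  moreover have "c ` K \<subseteq> {..<k}"
    using assms unfolding clique_def proper_colouring_def by blast
  ultimately show ?thesis
    using card_inj_on_le[of c K "{..<k}"] by simp
qed

text \<open>A clique bounds the number of colours from below and a colouring bounds the sizes of
  cliques from above, so a clique and a colouring of the same size certify each other as
  optimal.\<close>

lemma chromatic_number_eq_clique_number:
  assumes K: "clique H K" and c: "proper_colouring H (card K) c"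
  shows "chromatic_number H = clique_number H"
proof -
  have "chromatic_number H = card K"
    unfolding chromatic_number_def using c clique_card_le[OF K] by (intro Least_equality) auto
  moreover have "card ` {L. clique H L} \<subseteq> {..card K}"
    using clique_card_le[OF _ c] by auto
  then have "clique_number H = card K"
    unfolding clique_number_def using K
    by (intro Max_eqI) (auto intro: finite_subset)
  ultimately show ?thesis by simp
qed

text \<open>The certifying clique is an edge, a single vertex or the empty set, depending on whether
  there are arcs and vertices at all.\<close>

lemma (in sym_digraph) chromatic_number_bipartite:
  assumes c: "proper_colouring G 2 c"
  shows "chromatic_number G = clique_number G"
proof -
  consider u v where "(u, v) \<in> arcs_ends G" | v where "arcs_ends G = {}" "v \<in> verts G"
    | "arcs_ends G = {}" "verts G = {}"
    by fast
  then show ?thesis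
  proof cases
    case 1
    \<comment> \<open>\<open>sym_digraph\<close> admits loops; here the colouring rules them
      out.\<close>
    then have "u \<noteq> v" "(v, u) \<in> arcs_ends G"
      using c by (auto simp: proper_colouring_def intro: graph_symmetric)
    then have "clique G {u, v}" "card {u, v} = 2"
      using 1 by (auto simp: clique_def adj_in_verts)
    then show ?thesis
      using c by (intro chromatic_number_eq_clique_number) auto
  next
    case 2
    \<comment> \<open>\<open>c\<close> may use both colours even without arcs, so a constant
      colouring replaces it.\<close>
    then show ?thesis
      by (intro chromatic_number_eq_clique_number[of _ "{v}" "\<lambda>_. 0"])
        (auto simp: clique_def proper_colouring_def)
  next
    case 3
    then show ?thesis
      by (intro chromatic_number_eq_clique_number[of _ "{}" c])
        (auto simp: clique_def proper_colouring_def)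
  qed
qed

text \<open>The same \<open>c\<close> colours every induced subgraph, and symmetry is inherited
  too.\<close>

lemma (in sym_digraph) perfect_graph_bipartite:
  assumes c: "proper_colouring G 2 c"
  shows "perfect_graph G"
  unfolding perfect_graph_def
proof (intro allI impI)
  fix W assume W: "W \<subseteq> verts G"
  have ind: "induced_subgraph (G \<restriction> W) G"
    using W by (rule induced_induce)
  interpret W: sym_digraph "G \<restriction> W"
    using W ind induced_graph_imp_symmetric[OF sym_arcs ind]
    by (auto simp: sym_digraph_def sym_digraph_axioms_def)
  have "arcs_ends (G \<restriction> W) \<subseteq> arcs_ends G"
    by (auto simp: arcs_ends_conv)
  then have "proper_colouring (G \<restriction> W) 2 c"
    using c W unfolding proper_colouring_def by auto
  then show "chromatic_number (G \<restriction> W) = clique_number (G \<restriction> W)"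
    by (rule W.chromatic_number_bipartite)
qed

text \<open>With \<open>g = gcd (ord z) j\<close>, the powers of \<open>z [^] j\<close> are exactly
  those of \<open>z [^] g\<close>. Divisibility of the orders forces \<open>g\<close> to divide
  \<open>i\<close>.\<close>

lemma (in group) int_pow_mem_generate:
  assumes z: "z \<in> carrier G" and "ord z \<noteq> 0"
    and ord: "ord (z [^] (i::int)) dvd ord (z [^] (j::int))"
  shows "z [^] i \<in> generate G {z [^] j}"
proof -
  define g where "g = gcd (int (ord z)) j"
  have g: "g dvd int (ord z)" "g dvd j"
    by (auto simp: g_def)
  then obtain r where r: "int (ord z) = g * r" by blast
  then have "r \<noteq> 0"
    using assms(2) by auto
  \<comment> \<open>The exponent \<open>r = ord z / g\<close> kills \<open>z [^] j\<close>, hence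
    also \<open>z [^] i\<close>; cancelling \<open>r\<close> then leaves
    \<open>g dvd i\<close>.\<close>
  have "int (ord z) dvd j * r"
    using g(2) r by (simp add: mult_dvd_mono)
  then have "(z [^] j) [^] r = \<one>"
    using z int_pow_eq_id[OF z, of "j * r"] by (simp add: int_pow_pow)
  then have "int (ord (z [^] j)) dvd r"
    using int_pow_eq_id[of "z [^] j" r] z by simp
  then have "int (ord (z [^] i)) dvd r"
    using ord by (meson dvd_trans of_nat_dvd_iff)
  then have "(z [^] i) [^] r = \<one>"
    using int_pow_eq_id[of "z [^] i" r] z by simp
  then have "int (ord z) dvd i * r"
    using z int_pow_eq_id[OF z, of "i * r"] by (simp add: int_pow_pow)
  then obtain k where k: "i = g * k"
    using r \<open>r \<noteq> 0\<close> by auto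
  \<comment> \<open>Bezout makes \<open>i\<close> a multiple of \<open>j\<close> modulo
    \<open>ord z\<close>.\<close>
  obtain u v where "u * int (ord z) + v * j = g"
    using bezout_int g_def by blast
  then have "i = k * (u * int (ord z) + v * j)"
    by (simp add: k)
  then have "i - j * (v * k) = int (ord z) * (u * k)"
    by (simp add: algebra_simps)
  then have "z [^] (j * (v * k)) = z [^] i"
    using int_pow_eq[OF z] dvd_triv_left by metis
  then have "z [^] i = (z [^] j) [^] (v * k)"
    using z by (simp add: int_pow_pow)
  then show ?thesis
    using z by (auto simp: generate_pow)
qed

text \<open>Both elements are powers of one generator \<open>z\<close>, whose order is nonzero
  because the group is finite.\<close>

lemma (in group) mem_generate_if_ord_dvd:
  assumes fin: "finite (carrier G)" and x: "x \<in> carrier G" and y: "y \<in> carrier G"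
    and cyc: "cyclic_group (subgroup_generated G {x, y})" and ord: "ord x dvd ord y"
  shows "x \<in> generate G {y}"
proof -
  let ?K = "subgroup_generated G {x, y}"
  interpret K: group ?K by simp
  obtain z where z: "z \<in> carrier ?K" and K: "carrier ?K = range (\<lambda>n::int. z [^]\<^bsub>?K\<^esub> n)"
    using cyc K.cyclic_group by blast
  have zG: "z \<in> carrier G"
    using z carrier_subgroup_generated_subset by blast
  have "x \<in> carrier ?K" "y \<in> carrier ?K"
    using subgroup_generated_subset_carrier_subset[of "{x, y}"] x y by auto
  then obtain i j :: int where "x = z [^] i" "y = z [^] j"
    unfolding K using z by (auto simp: int_pow_subgroup_generated)
  moreover have "ord z \<noteq> 0"
    using ord_ge_1[OF fin zG] by simp
  ultimately show ?thesis
    using int_pow_mem_generate[OF zG] ord by simp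
qed

lemma dvd_prime_power_linear:
  fixes p :: nat
  assumes "prime p" "a dvd p ^ n" "b dvd p ^ n"
  shows "a dvd b \<or> b dvd a"
  using assms by (metis divides_primepow_nat le_imp_power_dvd nat_le_linear)

text \<open>Cancelling a common factor \<open>q\<close>, or using coprimality to \<open>q\<close>,
  reduces to divisors of \<open>p ^ n\<close>, which form a chain.\<close>

lemma dvd_prime_power_times_prime_linear:
  fixes p q :: nat
  assumes p: "prime p" and q: "prime q"
    and a: "a dvd p ^ n * q" and b: "b dvd p ^ n * q" and ab: "q dvd a \<longleftrightarrow> q dvd b"
  shows "a dvd b \<or> b dvd a"
proof (cases "q dvd a")
  case True
  then obtain a' b' where "a = q * a'" "b = q * b'"
    using ab by blast
  moreover from this have "a' dvd p ^ n" "b' dvd p ^ n"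
    using a b q by (auto simp: mult.commute[of _ q] prime_gt_0_nat)
  ultimately show ?thesis
    using dvd_prime_power_linear[OF p] by (metis mult_dvd_mono dvd_refl)
next
  case False
  then have "coprime a q" "coprime b q"
    using ab prime_imp_coprime[OF q] by (auto simp: coprime_commute)
  then have "a dvd p ^ n" "b dvd p ^ n"
    using a b by (simp_all add: coprime_dvd_mult_left_iff)
  then show ?thesis
    using dvd_prime_power_linear[OF p] by blast
qed

lemma (in group) perfect_difference_graph:
  assumes p: "prime p" and q: "prime q" and ord_G: "order G = p ^ n * q"
  shows "perfect_graph (with_proj (difference_graph G))"
proof -
  have fin: "finite (carrier G)"
    using p q ord_G by (intro order_gt_0_iff_finite[THEN iffD1]) (simp add: prime_gt_0_nat)
  interpret D: pair_graph "difference_graph G"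
    using fin by (rule pair_graph_difference_graph)
  \<comment> \<open>Within each colour class the orders are linearly ordered by divisibility, which
    excludes arcs.\<close>
  define c where "c x = (if q dvd ord x then 1 else 0 :: nat)" for x
  have "c x \<noteq> c y" if xy: "(x, y) \<in> parcs (difference_graph G)" for x y
  proof
    assume "c x = c y"
    then have "q dvd ord x \<longleftrightarrow> q dvd ord y"
      by (simp add: c_def split: if_splits)
    moreover have G: "x \<in> carrier G" "y \<in> carrier G"
      using xy by (auto simp: difference_graph_def remove_isolated_def graph_difference_def
          enhanced_power_graph_def)
    ultimately have "ord x dvd ord y \<or> ord y dvd ord x"
      using dvd_prime_power_times_prime_linear[OF p q, of "ord x" n "ord y"]
        ord_dvd_group_order[of x] ord_dvd_group_order[of y]
      by (simp add: ord_G)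
    moreover have "cyclic_group (subgroup_generated G {x, y})"
      "x \<notin> generate G {y}" "y \<notin> generate G {x}"
      using xy difference_graph_adjacent_iff[OF G] by auto
    ultimately show False
      using mem_generate_if_ord_dvd[OF fin G] mem_generate_if_ord_dvd[OF fin G(2,1)]
      by (auto simp: insert_commute)
  qed
  moreover have "c x < 2" for x
    by (simp add: c_def)
  ultimately have "proper_colouring (with_proj (difference_graph G)) 2 c"
    by (auto simp: proper_colouring_def)
  then show ?thesis
    by (rule D.perfect_graph_bipartite)
qed

theorem theorem7p3:
  fixes G :: "('a, 'b) monoid_scheme" and p q :: nat
  assumes "prime p" and "prime q" and "p \<noteq> q"
    and "group G" and "order G = p ^ 3 * q"
  shows "perfect_graph (with_proj (difference_graph G))"
  using assms group.perfect_difference_graph by blast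

end
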